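(* Let $A$ be an abelian group. If $A$ is a slender group, then $A$ (regarded as a generalized group under its group operation) is a slender generalized group.
   Context: A generalized group is a semigroup $G$ such that (1) for each $x\in G$ there is a unique element $e(x)\in G$ with $e(x)x=xe(x)=x$, and (2) for each $x\in G$ there is $y\in G$ with $xy=yx=e(x)$. A homomorphism of generalized groups is a map $f:G\to H$ with $f(ab)=f(a)f(b)$ for all $a,b\in G$. Every group is a generalized group, with $e(x)$ the identity element for all $x$. Let $\mathbb{N}=\{1,2,3,\ldots\}$. For $n\in\mathbb{N}$, $i_n\in\prod_{\mathbb{N}}\mathbb{Z}$ denotes the sequence with $i_n(n)=1$ and $i_n(k)=0$ for $k\neq n$. With its usual coordinatewise addition, $\prod_{\mathbb{N}}\mathbb{Z}$ is an abelian group. An abelian group $A$ is a slender group if for every group homomorphism $h:\prod_{\mathbb{N}}\mathbb{Z}\to A$ the set $\{n\in\mathbb{N}\mid h(i_n)\neq 0\}$ is finite. $\prod_{\mathbb{N}}^{g}\mathbb{Z}$ denotes the generalized group with underlying set $\prod_{\mathbb{N}}\mathbb{Z}$ and operation $*$ given by $(x*y)_k=x_k$ if $k\equiv 1 \pmod 3$, $(x*y)_k=y_k$ if $k\equiv 2\pmod 3$, and $(x*y)_k=x_k+y_k$ if $k\equiv 0\pmod 3$. A generalized group $G$ is a slender generalized group if for every homomorphism of generalized groups $h:\prod_{\mathbb{N}}^{g}\mathbb{Z}\to G$ the set $\{n\in\mathbb{N}\mid h(i_n)\neq e(h(i_n))\}$ is finite. *)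

theory Defs
  imports "HOL-Algebra.Elementary_Groups" "HOL-Algebra.Product_Groups"
begin

(* Generalized groups live on the monoid records of HOL-Algebra, so that a group is literally
   a structure of the same kind and the library's hom (maps between the carriers that
   preserve the product, with no condition on the unit) is the notion of homomorphism.
   A generalized group has no distinguished unit: the field one is ignored throughout. *)

definition local_unit :: "('a, 'b) monoid_scheme \<Rightarrow> 'a \<Rightarrow> 'a" where
  "local_unit G x = (THE e. e \<in> carrier G \<and> e \<otimes>\<^bsub>G\<^esub> x = x \<and> x \<otimes>\<^bsub>G\<^esub> e = x)"

locale generalized_group =
  fixes G :: "('a, 'b) monoid_scheme" (structure)
  assumes m_closed: "\<lbrakk>x \<in> carrier G; y \<in> carrier G\<rbrakk> \<Longrightarrow> x \<otimes> y \<in> carrier G"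
    and m_assoc: "\<lbrakk>x \<in> carrier G; y \<in> carrier G; z \<in> carrier G\<rbrakk>
      \<Longrightarrow> (x \<otimes> y) \<otimes> z = x \<otimes> (y \<otimes> z)"
    and ex1_local_unit: "x \<in> carrier G \<Longrightarrow> \<exists>!e. e \<in> carrier G \<and> e \<otimes> x = x \<and> x \<otimes> e = x"
    and ex_inverse: "x \<in> carrier G
      \<Longrightarrow> \<exists>y\<in>carrier G. x \<otimes> y = local_unit G x \<and> y \<otimes> x = local_unit G x"

(* Integer sequences are indexed by 1, 2, 3, ..., as extensional functions on {1..}
   (value undefined at 0). *)

definition int_sequences :: "(nat \<Rightarrow> int) monoid" where
  "int_sequences = product_group {1..} (\<lambda>_. integer_group)"

definition unit_sequence :: "nat \<Rightarrow> nat \<Rightarrow> int" where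
  "unit_sequence n = (\<lambda>k\<in>{1..}. if k = n then 1 else 0)"

(* Only the product is replaced; the field one keeps the zero sequence, which is not an
   identity element for the new product. *)

definition gen_int_sequences :: "(nat \<Rightarrow> int) monoid" where
  "gen_int_sequences = int_sequences
    \<lparr>monoid.mult := \<lambda>x y. \<lambda>k\<in>{1..}.
       if k mod 3 = 1 then x k else if k mod 3 = 2 then y k else x k + y k\<rparr>"

definition slender_group :: "('a, 'b) monoid_scheme \<Rightarrow> bool" where
  "slender_group A \<longleftrightarrow> comm_group A \<and>
    (\<forall>h\<in>hom int_sequences A. finite {n\<in>{1..}. h (unit_sequence n) \<noteq> \<one>\<^bsub>A\<^esub>})"

definition slender_generalized_group :: "('a, 'b) monoid_scheme \<Rightarrow> bool" where
  "slender_generalized_group G \<longleftrightarrow> generalized_group G \<and>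
    (\<forall>h\<in>hom gen_int_sequences G.
      finite {n\<in>{1..}. h (unit_sequence n) \<noteq> local_unit G (h (unit_sequence n))})"

lemma carrier_gen_int_sequences: "carrier gen_int_sequences = (\<Pi>\<^sub>E k\<in>{1..}. UNIV)"
  by (simp add: gen_int_sequences_def int_sequences_def)

lemma mult_gen_int_sequences:
  "x \<otimes>\<^bsub>gen_int_sequences\<^esub> y =
    (\<lambda>k\<in>{1..}. if k mod 3 = 1 then x k else if k mod 3 = 2 then y k else x k + y k)"
  by (simp add: gen_int_sequences_def)

lemma unit_sequence_in_carrier: "unit_sequence n \<in> carrier gen_int_sequences"
  by (simp add: carrier_gen_int_sequences unit_sequence_def)

lemma generalized_group_gen_int_sequences: "generalized_group gen_int_sequences"
proof -
  let ?G = gen_int_sequences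
  let ?e = "\<lambda>x::nat \<Rightarrow> int. \<lambda>k\<in>{1..}. if k mod 3 = 0 then 0 else x k"
  have unit: "e \<in> carrier ?G \<and> e \<otimes>\<^bsub>?G\<^esub> x = x \<and> x \<otimes>\<^bsub>?G\<^esub> e = x \<longleftrightarrow> e = ?e x"
    if x: "x \<in> carrier ?G" for x e
  proof
    assume e: "e \<in> carrier ?G \<and> e \<otimes>\<^bsub>?G\<^esub> x = x \<and> x \<otimes>\<^bsub>?G\<^esub> e = x"
    show "e = ?e x"
    proof
      fix k :: nat
      have eqs: "(e \<otimes>\<^bsub>?G\<^esub> x) k = x k" "(x \<otimes>\<^bsub>?G\<^esub> e) k = x k"
        using e by auto
      have "k mod 3 = 0 \<or> k mod 3 = 1 \<or> k mod 3 = 2" by arith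
      with eqs e show "e k = ?e x k"
        by (cases "k \<ge> 1") (auto simp: mult_gen_int_sequences carrier_gen_int_sequences PiE_def
            extensional_def)
    qed
  next
    assume e: "e = ?e x"
    have "k mod 3 = 0 \<or> k mod 3 = 1 \<or> k mod 3 = 2" for k :: nat by arith
    with x e show "e \<in> carrier ?G \<and> e \<otimes>\<^bsub>?G\<^esub> x = x \<and> x \<otimes>\<^bsub>?G\<^esub> e = x"
      by (auto simp: mult_gen_int_sequences carrier_gen_int_sequences PiE_def extensional_def
          fun_eq_iff)
  qed
  have lu: "local_unit ?G x = ?e x" if "x \<in> carrier ?G" for x
    unfolding local_unit_def unit[OF that] by simp
  show ?thesis
  proof
    fix x assume x: "x \<in> carrier ?G"
    show "\<exists>!e. e \<in> carrier ?G \<and> e \<otimes>\<^bsub>?G\<^esub> x = x \<and> x \<otimes>\<^bsub>?G\<^esub> e = x"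
      unfolding unit[OF x] by simp
    let ?y = "\<lambda>k\<in>{1..}. if k mod 3 = 0 then - x k else x k"
    have "?y \<in> carrier ?G" by (simp add: carrier_gen_int_sequences)
    moreover have "k mod 3 = 0 \<or> k mod 3 = 1 \<or> k mod 3 = 2" for k :: nat by arith
    then have "x \<otimes>\<^bsub>?G\<^esub> ?y = ?e x" "?y \<otimes>\<^bsub>?G\<^esub> x = ?e x"
      by (auto simp: mult_gen_int_sequences fun_eq_iff)
    ultimately show "\<exists>y\<in>carrier ?G. x \<otimes>\<^bsub>?G\<^esub> y = local_unit ?G x \<and> y \<otimes>\<^bsub>?G\<^esub> x = local_unit ?G x"
      unfolding lu[OF x] by blast
  qed (auto simp: mult_gen_int_sequences carrier_gen_int_sequences fun_eq_iff)
qed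

end

theory Submission
  imports Defs
begin

text \<open>
  A homomorphism into a group kills every idempotent, since the identity is the only idempotent
  of a group. In the generalized group of integer sequences the idempotents are the sequences
  vanishing at all multiples of 3, and every sequence \<open>x\<close> factors as \<open>a * p * a\<close> with \<open>a\<close>
  idempotent and \<open>p\<close> the part of \<open>x\<close> on the multiples of 3. A homomorphism \<open>h\<close> from it to a group
  is therefore unchanged by precomposition with \<open>x \<mapsto> p\<close>. The point is that \<open>x \<mapsto> p\<close> is also a
  homomorphism from the ordinary, coordinatewise product: where the two operations disagree, both
  factors have been replaced by 0. So \<open>h\<close>, as a map, is a homomorphism of ordinary groups as well,
  and slenderness of the target applies to it.
\<close>

lemma mult_int_sequences: "x \<otimes>\<^bsub>int_sequences\<^esub> y = (\<lambda>k\<in>{1..}. x k + y k)"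
  by (simp add: int_sequences_def)

lemma carrier_int_sequences: "carrier int_sequences = (\<Pi>\<^sub>E k\<in>{1..}. UNIV)"
  by (simp add: int_sequences_def)

lemma (in group) local_unit_eq_one:
  assumes "x \<in> carrier G"
  shows "local_unit G x = \<one>"
  unfolding local_unit_def using assms by (intro the_equality) auto

lemma (in group) generalized_group: "generalized_group G"
proof
  show "\<exists>!e. e \<in> carrier G \<and> e \<otimes> x = x \<and> x \<otimes> e = x" if "x \<in> carrier G" for x
    using that by (intro ex1I[of _ \<one>]) auto
  show "\<exists>y\<in>carrier G. x \<otimes> y = local_unit G x \<and> y \<otimes> x = local_unit G x"
    if "x \<in> carrier G" for x
    using that by (intro bexI[of _ "inv x"]) (auto simp: local_unit_eq_one)
qed (auto simp: m_assoc)

lemma (in group) hom_idempotent_eq_one: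
  assumes "h \<in> hom S G" and "a \<in> carrier S" and "a \<otimes>\<^bsub>S\<^esub> a = a"
  shows "h a = \<one>"
proof -
  have "h a \<otimes> h a = h a" using hom_mult[OF assms(1,2,2)] assms(3) by simp
  then show ?thesis using hom_in_carrier[OF assms(1,2)] by simp
qed

definition multiples_of_3_part :: "(nat \<Rightarrow> int) \<Rightarrow> nat \<Rightarrow> int" where
  "multiples_of_3_part x = (\<lambda>k\<in>{1..}. if k mod 3 = 0 then x k else 0)"

lemma multiples_of_3_part_hom: "multiples_of_3_part \<in> hom int_sequences gen_int_sequences"
  by (auto simp: hom_def carrier_gen_int_sequences mult_gen_int_sequences mult_int_sequences
      multiples_of_3_part_def fun_eq_iff)

text \<open>
  With \<open>a\<close> the part of \<open>x\<close> away from the multiples of 3, the left factor of \<open>a * p * a\<close> supplies the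
  coordinates congruent to 1, the right factor those congruent to 2, and \<open>p\<close> the others.
\<close>

lemma (in group) hom_gen_int_sequences_multiples_of_3_part:
  assumes h: "h \<in> hom gen_int_sequences G" and x: "x \<in> carrier gen_int_sequences"
  shows "h (multiples_of_3_part x) = h x"
proof -
  let ?S = gen_int_sequences
  let ?p = "multiples_of_3_part x"
  define a :: "nat \<Rightarrow> int" where "a = (\<lambda>k\<in>{1..}. if k mod 3 = 0 then 0 else x k)"
  have a: "a \<in> carrier ?S" and p: "?p \<in> carrier ?S"
    by (auto simp: a_def multiples_of_3_part_def carrier_gen_int_sequences)
  have ap: "a \<otimes>\<^bsub>?S\<^esub> ?p \<in> carrier ?S"
    by (simp add: mult_gen_int_sequences carrier_gen_int_sequences)
  have "a \<otimes>\<^bsub>?S\<^esub> a = a"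
    by (auto simp: a_def mult_gen_int_sequences fun_eq_iff)
  then have ha: "h a = \<one>" by (rule hom_idempotent_eq_one[OF h a])
  have "k mod 3 = 0 \<or> k mod 3 = 1 \<or> k mod 3 = 2" for k :: nat by arith
  then have "a \<otimes>\<^bsub>?S\<^esub> ?p \<otimes>\<^bsub>?S\<^esub> a = x"
    using x by (auto simp: a_def multiples_of_3_part_def mult_gen_int_sequences
        carrier_gen_int_sequences PiE_def extensional_def fun_eq_iff)
  then have "h x = h a \<otimes> h ?p \<otimes> h a"
    using hom_mult[OF h ap a] hom_mult[OF h a p] by simp
  then show ?thesis using ha hom_in_carrier[OF h p] by simp
qed

lemma (in group) hom_gen_int_sequences_imp_hom_int_sequences:
  assumes h: "h \<in> hom gen_int_sequences G"
  shows "h \<in> hom int_sequences G"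
proof -
  have "h \<circ> multiples_of_3_part \<in> hom int_sequences G"
    by (rule Group.hom_compose[OF multiples_of_3_part_hom h])
  moreover have "(h \<circ> multiples_of_3_part) x = h x" if "x \<in> carrier int_sequences" for x
    using hom_gen_int_sequences_multiples_of_3_part[OF h] that
    by (simp add: carrier_int_sequences carrier_gen_int_sequences)
  moreover have "x \<otimes>\<^bsub>int_sequences\<^esub> y \<in> carrier int_sequences" for x y
    by (simp add: mult_int_sequences carrier_int_sequences)
  ultimately show ?thesis by (auto simp: hom_def Pi_iff)
qed

theorem theorem1p10:
  fixes A :: "('a, 'b) monoid_scheme"
  assumes "comm_group A"
    and "slender_group A"
  shows "slender_generalized_group A"
proof -
  interpret comm_group A by fact
  have "finite {n\<in>{1..}. h (unit_sequence n) \<noteq> local_unit A (h (unit_sequence n))}"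
    if h: "h \<in> hom gen_int_sequences A" for h
  proof -
    have "local_unit A (h (unit_sequence n)) = \<one>\<^bsub>A\<^esub>" for n
      by (rule local_unit_eq_one[OF hom_in_carrier[OF h unit_sequence_in_carrier]])
    then show ?thesis
      using assms(2) hom_gen_int_sequences_imp_hom_int_sequences[OF h]
      by (simp add: slender_group_def)
  qed
  then show ?thesis
    using generalized_group by (simp add: slender_generalized_group_def)
qed

end
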